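(* Let $m$ be fixed and let the $X_{i,j}$ ($1\leq j\leq m$, $1\leq i\leq n_j$) be i.i.d. with a common distribution satisfying condition $\mathcal{C}_2(\gamma,\rho,A)$ (stated in the context). Suppose that, as $n\to\infty$, $n_1/n_j\to b_j\in(0,\infty)$ and $k_1/k_j\to c_j\in(0,\infty)$ (with then $b_1=c_1=1$) for any $j\in\{1,\ldots,m\}$, and that $k=\sum_{j=1}^mk_j\to\infty$ with $k/n\to0$ and $\sqrt{k}A(n/k)\to\lambda\in\mathbb{R}$. Let $d_j=(c_j/b_j)\times(\sum_{i=1}^mc_i^{-1})/(\sum_{i=1}^mb_i^{-1})$ and set $$\mathrm{AMSE}^{(\mathrm{Hill})}=\frac1k\left(\frac{\lambda^2}{(1-\rho)^2}+\gamma^2\right),\qquad \mathrm{AMSE}(\boldsymbol{\omega})=\frac1k\left((\boldsymbol{\omega}^\top\boldsymbol{B}_{\boldsymbol{c}})^2+\boldsymbol{\omega}^\top\mathbf{V}_{\boldsymbol{c}}\boldsymbol{\omega}\right),$$ with $$\boldsymbol{B}_{\boldsymbol{c}}=\frac{\lambda}{1-\rho}(d_1^\rho,\ldots,d_m^\rho)^\top,\qquad \mathbf{V}_{\boldsymbol{c}}=\gamma^2\left(\sum_{i=1}^mc_i^{-1}\right)\operatorname{diag}(c_1,\ldots,c_m).$$ Let $\boldsymbol{\omega}^{(\mathrm{AMSE})}$ be the unique minimizer of $\mathrm{AMSE}(\boldsymbol{\omega})$ over $\boldsymbol{\omega}\in\mathbb{R}^m$ subject to $\boldsymbol{\omega}^\top\boldsymbol{1}=1$.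 Assume that the $b_j/c_j$ are not all equal to $1$. Then $\mathrm{AMSE}(\boldsymbol{\omega}^{(\mathrm{AMSE})})\geq\mathrm{AMSE}^{(\mathrm{Hill})}$ if and only if $|\lambda|\leq\lambda_0$, with $$\lambda_0=\gamma(1-\rho)\sqrt{\frac{S_\rho^2-S_0^2}{S_0S_{2\rho}-S_\rho^2}},\qquad S_\alpha=\sum_{j=1}^m d_j^\alpha/c_j.$$
   Context: Here $n_j=n_j(n)$, $n=\sum_{j=1}^mn_j$ is the total sample size, $k_j=k_j(n)\geq1$ are integers, and $\boldsymbol{1}$ is the vector of ones in $\mathbb{R}^m$. The common distribution function $F$ is continuous, with tail quantile function $U(t)=\inf\{x\in\mathbb{R}:1/(1-F(x))\geq t\}$. Condition $\mathcal{C}_2(\gamma,\rho,A)$: $\gamma>0$, $\rho\leq0$, $A$ has constant sign and converges to $0$ at infinity, and for all $x>0$, $\lim_{t\to\infty}\frac{1}{A(t)}\left[\frac{U(tx)}{U(t)}-x^\gamma\right]=x^\gamma\frac{x^\rho-1}{\rho}$ (read as $x^\gamma\log x$ if $\rho=0$). Interpretation: $\mathrm{AMSE}(\boldsymbol{\omega})$ and $\mathrm{AMSE}^{(\mathrm{Hill})}$ are the asymptotic mean squared errors of, respectively, the weighted average $\sum_j\omega_j\widehat{\gamma}_j(k_j)$ of the subsample Hill estimators (with $k_j$ top order statistics in subsample $j$) and the Hill estimator computed from the combined sample of size $n$ with $k$ top order statistics. The explicit form of the minimizer is $$\boldsymbol{\omega}^{(\mathrm{AMSE})}=\frac{(1+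\boldsymbol{B}_{\boldsymbol{c}}^\top\mathbf{V}_{\boldsymbol{c}}^{-1}\boldsymbol{B}_{\boldsymbol{c}})\mathbf{V}_{\boldsymbol{c}}^{-1}\boldsymbol{1}-(\boldsymbol{1}^\top\mathbf{V}_{\boldsymbol{c}}^{-1}\boldsymbol{B}_{\boldsymbol{c}})\mathbf{V}_{\boldsymbol{c}}^{-1}\boldsymbol{B}_{\boldsymbol{c}}}{(1+\boldsymbol{B}_{\boldsymbol{c}}^\top\mathbf{V}_{\boldsymbol{c}}^{-1}\boldsymbol{B}_{\boldsymbol{c}})(\boldsymbol{1}^\top\mathbf{V}_{\boldsymbol{c}}^{-1}\boldsymbol{1})-(\boldsymbol{1}^\top\mathbf{V}_{\boldsymbol{c}}^{-1}\boldsymbol{B}_{\boldsymbol{c}})^2}.$$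
   Formalization: For ρ=0, which the condition allows, the formula for λ_0 is 0/0 and undefined; the formal statement takes λ_0=+∞ there (its limit as ρ→0), and uses the stated formula for all ρ<0. *)

theory Defs
  imports "HOL-Probability.Probability"
begin

text \<open>The quotient is taken in the extended reals, so that $1/(1-F(x)) = \infty$ when $F(x) = 1$
  (over the reals it would be $0$).\<close>

definition tail_quantile :: "(real \<Rightarrow> real) \<Rightarrow> real \<Rightarrow> real" where
  "tail_quantile F t = Inf {x. 1 / ereal (1 - F x) \<ge> ereal t}"

text \<open>Constant sign is only required near infinity, and includes being nonzero there,
  since the limit relation divides by \<open>A\<close>.\<close>

definition second_order_C2 ::
  "(real \<Rightarrow> real) \<Rightarrow> real \<Rightarrow> real \<Rightarrow> (real \<Rightarrow> real) \<Rightarrow> bool" where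
  "second_order_C2 F \<gamma> \<rho> A \<longleftrightarrow>
     \<gamma> > 0 \<and> \<rho> \<le> 0 \<and>
     ((\<forall>\<^sub>F t in at_top. A t > 0) \<or> (\<forall>\<^sub>F t in at_top. A t < 0)) \<and>
     (A \<longlongrightarrow> 0) at_top \<and>
     (\<forall>x>0. ((\<lambda>t. (1 / A t) * (tail_quantile F (t * x) / tail_quantile F t - x powr \<gamma>))
        \<longlongrightarrow> x powr \<gamma> * (if \<rho> = 0 then ln x else (x powr \<rho> - 1) / \<rho>)) at_top)"

definition dvec :: "real ^ 'm \<Rightarrow> real ^ 'm \<Rightarrow> real ^ 'm" where
  "dvec b c = (\<chi> j. (c $ j / b $ j) * ((\<Sum>i\<in>UNIV. 1 / c $ i) / (\<Sum>i\<in>UNIV. 1 / b $ i)))"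

definition Ssum :: "real ^ 'm \<Rightarrow> real ^ 'm \<Rightarrow> real \<Rightarrow> real" where
  "Ssum b c \<alpha> = (\<Sum>j\<in>UNIV. dvec b c $ j powr \<alpha> / c $ j)"

definition diag_mat :: "real ^ 'm \<Rightarrow> real ^ 'm ^ 'm" where
  "diag_mat v = (\<chi> i j. if i = j then v $ i else 0)"

definition bias_vec :: "real \<Rightarrow> real \<Rightarrow> real ^ 'm \<Rightarrow> real ^ 'm \<Rightarrow> real ^ 'm" where
  "bias_vec lam \<rho> b c = (lam / (1 - \<rho>)) *\<^sub>R (\<chi> j. dvec b c $ j powr \<rho>)"

definition var_mat :: "real \<Rightarrow> real ^ 'm \<Rightarrow> real ^ 'm ^ 'm" where
  "var_mat \<gamma> c = (\<gamma>\<^sup>2 * (\<Sum>i\<in>UNIV. 1 / c $ i)) *\<^sub>R diag_mat c"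

definition AMSE_Hill :: "nat \<Rightarrow> real \<Rightarrow> real \<Rightarrow> real \<Rightarrow> real" where
  "AMSE_Hill k \<gamma> \<rho> lam = (1 / real k) * (lam\<^sup>2 / (1 - \<rho>)\<^sup>2 + \<gamma>\<^sup>2)"

definition AMSE ::
  "nat \<Rightarrow> real \<Rightarrow> real \<Rightarrow> real \<Rightarrow> real ^ 'm \<Rightarrow> real ^ 'm \<Rightarrow> real ^ 'm \<Rightarrow> real" where
  "AMSE k \<gamma> \<rho> lam b c \<omega> =
     (1 / real k) * ((\<omega> \<bullet> bias_vec lam \<rho> b c)\<^sup>2 + \<omega> \<bullet> (var_mat \<gamma> c *v \<omega>))"

definition is_AMSE_minimizer ::
  "nat \<Rightarrow> real \<Rightarrow> real \<Rightarrow> real \<Rightarrow> real ^ 'm \<Rightarrow> real ^ 'm \<Rightarrow> real ^ 'm \<Rightarrow> bool" where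
  "is_AMSE_minimizer k \<gamma> \<rho> lam b c \<omega> \<longleftrightarrow>
     is_arg_min (AMSE k \<gamma> \<rho> lam b c) (\<lambda>w. w \<bullet> 1 = 1) \<omega>"

definition omega_AMSE ::
  "nat \<Rightarrow> real \<Rightarrow> real \<Rightarrow> real \<Rightarrow> real ^ 'm \<Rightarrow> real ^ 'm \<Rightarrow> real ^ 'm" where
  "omega_AMSE k \<gamma> \<rho> lam b c = (THE \<omega>. is_AMSE_minimizer k \<gamma> \<rho> lam b c \<omega>)"

text \<open>By Cauchy--Schwarz the denominator is nonnegative, and (for positive \<open>b\<close>, \<open>c\<close>) it vanishes
  only if $\rho = 0$ or all $d_j$ are equal, where the quotient under the root is $0/0$.
  The threshold is then taken to be $\infty$, its limit as $\rho \to 0$ for $d_j$ not all equal.\<close>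

definition lambda0 :: "real \<Rightarrow> real \<Rightarrow> real ^ 'm \<Rightarrow> real ^ 'm \<Rightarrow> ereal" where
  "lambda0 \<gamma> \<rho> b c =
     (let S = Ssum b c; D = S 0 * S (2 * \<rho>) - (S \<rho>)\<^sup>2
      in if D = 0 then \<infinity>
         else ereal (\<gamma> * (1 - \<rho>) * sqrt (((S \<rho>)\<^sup>2 - (S 0)\<^sup>2) / D)))"

end

theory Submission
  imports Defs
begin

text \<open>Write \<open>\<mu> = \<lambda>/(1 - \<rho>)\<close>. The form \<open>V + B B\<^sup>T\<close> is positive definite, so the constrained minimum is
  attained exactly at the point where its gradient is parallel to \<open>1\<close>; by the Sherman--Morrison formula
  the minimum equals \<open>(1 + e) / ((1 + e) a - p\<^sup>2)\<close> with \<open>a = 1\<^sup>TV\<^sup>-\<^sup>11\<close>, \<open>p = 1\<^sup>TV\<^sup>-\<^sup>1B\<close>, \<open>e = B\<^sup>TV\<^sup>-\<^sup>1B\<close>.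
  Comparing it with \<open>\<mu>\<^sup>2 + \<gamma>\<^sup>2\<close> and clearing denominators gives, for \<open>\<mu> \<noteq> 0\<close>, the condition
  \<open>\<mu>\<^sup>2 (S\<^sub>0 S\<^sub>2\<^sub>\<rho> - S\<^sub>\<rho>\<^sup>2) \<le> \<gamma>\<^sup>2 (S\<^sub>\<rho>\<^sup>2 - S\<^sub>0\<^sup>2)\<close>. The left bracket is nonnegative by Cauchy--Schwarz. The weights
  \<open>1/(c\<^sub>j S\<^sub>0)\<close> give the \<open>d\<^sub>j\<close> mean 1, so the right bracket is nonnegative by Jensen's inequality.\<close>

section \<open>Two elementary inequalities\<close>

lemma Cauchy_Schwarz_weighted_sum:
  fixes q x :: "'a \<Rightarrow> real"
  assumes "\<And>i. i \<in> I \<Longrightarrow> q i \<ge> 0"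
  shows "(\<Sum>i\<in>I. q i * x i)\<^sup>2 \<le> (\<Sum>i\<in>I. q i) * (\<Sum>i\<in>I. q i * (x i)\<^sup>2)"
proof -
  have "(\<Sum>i\<in>I. sqrt (q i) * (sqrt (q i) * x i))\<^sup>2
      \<le> (\<Sum>i\<in>I. (sqrt (q i))\<^sup>2) * (\<Sum>i\<in>I. (sqrt (q i) * x i)\<^sup>2)"
    by (rule Cauchy_Schwarz_ineq_sum)
  also have "(\<Sum>i\<in>I. sqrt (q i) * (sqrt (q i) * x i)) = (\<Sum>i\<in>I. q i * x i)"
    using assms by (intro sum.cong) (auto simp flip: mult.assoc)
  also have "(\<Sum>i\<in>I. (sqrt (q i))\<^sup>2) = (\<Sum>i\<in>I. q i)"
    using assms by (intro sum.cong) auto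
  also have "(\<Sum>i\<in>I. (sqrt (q i) * x i)\<^sup>2) = (\<Sum>i\<in>I. q i * (x i)\<^sup>2)"
    using assms by (intro sum.cong) (auto simp: power_mult_distrib)
  finally show ?thesis .
qed

text \<open>Tangent line at 1 of a convex power: \<open>ln x \<le> x - 1\<close> reverses under
  multiplication by \<rho>, and exp lies above its tangent at 0.\<close>

lemma powr_ge_tangent:
  fixes x \<rho> :: real
  assumes "x > 0" "\<rho> \<le> 0"
  shows "1 + \<rho> * (x - 1) \<le> x powr \<rho>"
proof -
  have "\<rho> * (x - 1) \<le> \<rho> * ln x"
    using assms ln_le_minus_one by (intro mult_left_mono_neg) auto
  moreover have "1 + \<rho> * ln x \<le> x powr \<rho>"
    using assms exp_ge_add_one_self[of "\<rho> * ln x"] by (simp add: powr_def)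
  ultimately show ?thesis by linarith
qed

lemma AMSE_eq:
  "AMSE k \<gamma> \<rho> lam b c w = (1 / real k) * ((w \<bullet> bias_vec lam \<rho> b c)\<^sup>2 +
     (\<Sum>j\<in>UNIV. \<gamma>\<^sup>2 * (\<Sum>i\<in>UNIV. 1 / c $ i) * c $ j * (w $ j)\<^sup>2))"
proof -
  have "(var_mat \<gamma> c *v w) $ j = \<gamma>\<^sup>2 * (\<Sum>i\<in>UNIV. 1 / c $ i) * c $ j * w $ j" for j
    by (simp add: var_mat_def diag_mat_def matrix_vector_mult_def if_distrib
        if_distribR sum.delta cong: if_cong)
  then have "w \<bullet> (var_mat \<gamma> c *v w)
      = (\<Sum>j\<in>UNIV. \<gamma>\<^sup>2 * (\<Sum>i\<in>UNIV. 1 / c $ i) * c $ j * (w $ j)\<^sup>2)"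
    by (simp add: inner_vec_def power2_eq_square mult_ac)
  then show ?thesis by (simp add: AMSE_def)
qed

section \<open>Minimizing a diagonal plus rank-one quadratic form on a hyperplane\<close>

text \<open>Here \<open>v\<close> is the diagonal of V. The candidate \<open>ws\<close> is
  \<open>(V + B B\<^sup>T)\<^sup>-\<^sup>1 1\<close>, expanded by Sherman-Morrison and divided by
  its coordinate sum \<open>N / (1 + e)\<close>.\<close>

context
  fixes B v :: "real ^ 'm" and f :: "real ^ 'm \<Rightarrow> real"
    and a p e N :: real and ws :: "real ^ 'm"
  assumes v_pos: "\<And>j. v $ j > 0"
  defines "f \<equiv> \<lambda>w. (w \<bullet> B)\<^sup>2 + (\<Sum>j\<in>UNIV. v $ j * (w $ j)\<^sup>2)"
    and "a \<equiv> \<Sum>j\<in>UNIV. 1 / v $ j"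
    and "p \<equiv> \<Sum>j\<in>UNIV. B $ j / v $ j"
    and "e \<equiv> \<Sum>j\<in>UNIV. (B $ j)\<^sup>2 / v $ j"
    and "N \<equiv> (1 + e) * a - p\<^sup>2"
    and "ws \<equiv> \<chi> j. (1 + e - p * B $ j) / (v $ j * N)"
begin

text \<open>Cauchy-Schwarz with weights \<open>1 / v $ j\<close> gives
  \<open>p\<^sup>2 \<le> a * e\<close>, which leaves \<open>N \<ge> a\<close>.\<close>

lemma rank_one_denominator_pos: "N > 0"
proof -
  have "p\<^sup>2 \<le> a * e"
    using Cauchy_Schwarz_weighted_sum[of UNIV "\<lambda>j. 1 / v $ j" "\<lambda>j. B $ j"] v_pos
    by (simp add: a_def p_def e_def less_imp_le)
  moreover have "a > 0"
    unfolding a_def using v_pos by (intro sum_pos) auto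
  ultimately show ?thesis by (simp add: N_def algebra_simps)
qed

lemma rank_one_critical_point:
  shows "ws \<bullet> 1 = 1" and "ws \<bullet> B = p / N" and "v $ j * ws $ j = (1 + e - p * B $ j) / N"
proof -
  have N: "N \<noteq> 0" using rank_one_denominator_pos by simp
  have ws: "ws $ j = ((1 + e) * (1 / v $ j) - p * (B $ j / v $ j)) / N" for j
    using v_pos[of j] N by (simp add: ws_def field_simps)
  have "ws \<bullet> 1 = ((1 + e) * a - p * p) / N"
    by (simp add: inner_vec_def ws a_def p_def sum_divide_distrib sum_subtractf sum_distrib_left
        flip: sum_divide_distrib)
  also have "\<dots> = 1" using N by (simp add: N_def power2_eq_square)
  finally show "ws \<bullet> 1 = 1" .
  have "ws \<bullet> B = (\<Sum>j\<in>UNIV. ((1 + e) * (B $ j / v $ j) - p * ((B $ j)\<^sup>2 / v $ j)) / N)"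
    unfolding inner_vec_def by (rule sum.cong) (auto simp: ws field_simps power2_eq_square)
  also have "\<dots> = ((1 + e) * p - p * e) / N"
    unfolding p_def e_def by (simp add: sum_subtractf sum_distrib_left flip: sum_divide_distrib)
  also have "\<dots> = p / N" by (simp add: algebra_simps)
  finally show "ws \<bullet> B = p / N" .
  show "v $ j * ws $ j = (1 + e - p * B $ j) / N"
    using v_pos[of j] N by (simp add: ws_def field_simps)
qed

text \<open>The Lagrange condition \<open>(V + B B\<^sup>T) ws = ((1 + e) / N) 1\<close>, paired
  with \<open>x\<close>: the two terms \<open>p / N * (x \<bullet> B)\<close> cancel.\<close>

lemma rank_one_form_polar:
  "(x \<bullet> B) * (ws \<bullet> B) + (\<Sum>j\<in>UNIV. v $ j * ws $ j * x $ j) = (1 + e) / N * (x \<bullet> 1)"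
proof -
  have "(\<Sum>j\<in>UNIV. v $ j * ws $ j * x $ j) = (\<Sum>j\<in>UNIV. (1 + e) / N * x $ j - p / N * (x $ j * B $ j))"
    unfolding rank_one_critical_point
    by (rule sum.cong) (auto simp: field_simps diff_divide_distrib)
  also have "\<dots> = (1 + e) / N * (x \<bullet> 1) - p / N * (x \<bullet> B)"
    by (simp only: sum_subtractf inner_vec_def sum_distrib_left) simp
  finally show ?thesis by (simp add: rank_one_critical_point)
qed

text \<open>Completing the square at \<open>ws\<close>: the displacement is orthogonal to 1, so the
  cross term vanishes.\<close>

lemma rank_one_form_decomposition:
  assumes "w \<bullet> 1 = 1"
  shows "f w = (1 + e) / N + f (w - ws)"
proof -
  define x where "x = w - ws"
  have w: "w = ws + x" by (simp add: x_def)
  have x1: "x \<bullet> 1 = 0"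
    using assms rank_one_critical_point(1) by (simp add: x_def inner_diff_left)
  have expand: "f (ws + x) = f ws + f x
      + 2 * ((x \<bullet> B) * (ws \<bullet> B) + (\<Sum>j\<in>UNIV. v $ j * ws $ j * x $ j))"
    by (simp add: f_def inner_add_left power2_eq_square algebra_simps sum.distrib sum_distrib_left)
  \<comment> \<open>For \<open>x = ws\<close> the left side of the polar identity is
    \<open>f ws\<close> itself.\<close>
  have "f ws = (1 + e) / N"
    using rank_one_form_polar[of ws] rank_one_critical_point(1)
    by (simp add: f_def power2_eq_square mult_ac)
  then show ?thesis
    unfolding x_def[symmetric] w expand rank_one_form_polar x1 by simp
qed

lemma rank_one_form_pos:
  assumes "x \<noteq> 0"
  shows "f x > 0"
proof -
  obtain j where "x $ j \<noteq> 0" using assms by (auto simp: vec_eq_iff)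
  then have "(\<Sum>j\<in>UNIV. v $ j * (x $ j)\<^sup>2) > 0"
    using v_pos by (intro sum_pos2[of _ j]) (auto simp: less_imp_le)
  then show ?thesis unfolding f_def by (simp add: add_nonneg_pos)
qed

lemma rank_one_form_min:
  "is_arg_min f (\<lambda>w. w \<bullet> 1 = 1) w \<longleftrightarrow> w = ws" "f ws = (1 + e) / N"
proof -
  show min: "f ws = (1 + e) / N"
    using rank_one_form_decomposition[OF rank_one_critical_point(1)] by (simp add: f_def)
  have "f ws < f w" if "w \<bullet> 1 = 1" "w \<noteq> ws" for w
    using rank_one_form_decomposition[OF that(1)] rank_one_form_pos[of "w - ws"] that(2) min by simp
  then show "is_arg_min f (\<lambda>w. w \<bullet> 1 = 1) w \<longleftrightarrow> w = ws"
    using rank_one_critical_point(1) unfolding is_arg_min_def by (metis less_asym)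
qed

end

section \<open>The minimal AMSE in terms of the sums S\<close>

lemma dvec_pos:
  fixes b c :: "real ^ 'm"
  assumes "\<And>j. b $ j > 0" "\<And>j. c $ j > 0"
  shows "dvec b c $ j > 0"
  unfolding dvec_def using assms by (simp add: sum_pos)

text \<open>Positivity of the entries of \<open>dvec b c\<close> matters because
  \<open>0 powr 0 = 0\<close>.\<close>

lemma Ssum_0:
  fixes b c :: "real ^ 'm"
  assumes "\<And>j. b $ j > 0" "\<And>j. c $ j > 0"
  shows "Ssum b c 0 = (\<Sum>j\<in>UNIV. 1 / c $ j)"
  using less_imp_neq[OF dvec_pos[OF assms], symmetric] by (simp add: Ssum_def)

lemma Ssum_0_pos:
  fixes b c :: "real ^ 'm"
  assumes "\<And>j. b $ j > 0" "\<And>j. c $ j > 0"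
  shows "Ssum b c 0 > 0"
  unfolding Ssum_0[OF assms] using assms by (intro sum_pos) auto

lemma dvec_powr_double:
  "(dvec b c $ j powr \<rho>)\<^sup>2 = dvec b c $ j powr (2 * \<rho>)"
  by (simp add: power2_eq_square flip: powr_add)

text \<open>The rank-one result with \<open>v $ j = \<gamma>\<^sup>2 * S 0 * c $ j\<close> and
  \<open>B $ j = \<mu> * dvec b c $ j powr \<rho>\<close>; substituting these into its three sums
  gives the present \<open>a\<close>, \<open>p\<close>, \<open>e\<close>.\<close>

lemma AMSE_minimum:
  fixes b c :: "real ^ 'm" and \<gamma> \<rho> lam :: real
  assumes "k > 0" and "\<gamma> > 0" and b: "\<And>j. b $ j > 0" and c: "\<And>j. c $ j > 0"
  defines "S \<equiv> Ssum b c" and "\<mu> \<equiv> lam / (1 - \<rho>)"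
  defines "a \<equiv> 1 / \<gamma>\<^sup>2" and "p \<equiv> \<mu> * S \<rho> / (\<gamma>\<^sup>2 * S 0)" and "e \<equiv> \<mu>\<^sup>2 * S (2 * \<rho>) / (\<gamma>\<^sup>2 * S 0)"
  shows "\<exists>!\<omega>. is_AMSE_minimizer k \<gamma> \<rho> lam b c \<omega>"
    and "(1 + e) * a - p\<^sup>2 > 0"
    and "AMSE k \<gamma> \<rho> lam b c (omega_AMSE k \<gamma> \<rho> lam b c) = (1 / real k) * ((1 + e) / ((1 + e) * a - p\<^sup>2))"
proof -
  define v :: "real ^ 'm" where "v = (\<chi> j. \<gamma>\<^sup>2 * (\<Sum>i\<in>UNIV. 1 / c $ i) * c $ j)"
  define B where "B = bias_vec lam \<rho> b c"
  define f where "f = (\<lambda>w. (w \<bullet> B)\<^sup>2 + (\<Sum>j\<in>UNIV. v $ j * (w $ j)\<^sup>2))"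
  have S0: "S 0 = (\<Sum>i\<in>UNIV. 1 / c $ i)"
    unfolding S_def by (rule Ssum_0[OF b c])
  have S0_pos: "S 0 > 0" unfolding S_def by (rule Ssum_0_pos[OF b c])
  have v: "v $ j = \<gamma>\<^sup>2 * S 0 * c $ j" for j by (simp add: v_def S0)
  have v_pos: "v $ j > 0" for j using c[of j] S0_pos assms(2) by (simp add: v)
  have Bj: "B $ j = \<mu> * dvec b c $ j powr \<rho>" for j
    by (simp add: B_def bias_vec_def \<mu>_def)
  have "(\<Sum>j\<in>UNIV. 1 / v $ j) = S 0 / (\<gamma>\<^sup>2 * S 0)"
    unfolding v by (subst (2) S0) (simp add: sum_divide_distrib mult_ac)
  then have a: "(\<Sum>j\<in>UNIV. 1 / v $ j) = a" using S0_pos by (simp add: a_def)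
  have p: "(\<Sum>j\<in>UNIV. B $ j / v $ j) = p"
    unfolding v Bj p_def
    by (simp add: S_def Ssum_def[of b c \<rho>] sum_divide_distrib sum_distrib_left mult_ac)
  have e: "(\<Sum>j\<in>UNIV. (B $ j)\<^sup>2 / v $ j) = e"
    unfolding v Bj e_def power_mult_distrib dvec_powr_double S_def Ssum_def[of b c "2 * \<rho>"]
    by (simp add: sum_divide_distrib sum_distrib_left mult_ac)
  note min = rank_one_form_min[of v B, OF v_pos, folded f_def, unfolded a p e]
  show "(1 + e) * a - p\<^sup>2 > 0"
    using rank_one_denominator_pos[of v B, OF v_pos] by (simp add: a p e)
  have AMSE: "AMSE k \<gamma> \<rho> lam b c = (\<lambda>w. (1 / real k) * f w)"
    by (rule ext) (simp add: AMSE_eq f_def B_def v_def)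
  \<comment> \<open>The positive factor \<open>1 / real k\<close> does not change the
    minimizers.\<close>
  have arg_min: "is_AMSE_minimizer k \<gamma> \<rho> lam b c w \<longleftrightarrow> is_arg_min f (\<lambda>w. w \<bullet> 1 = 1) w" for w
    using assms(1) by (simp add: is_AMSE_minimizer_def is_arg_min_def AMSE divide_less_cancel)
  show "\<exists>!\<omega>. is_AMSE_minimizer k \<gamma> \<rho> lam b c \<omega>"
    unfolding arg_min min by simp
  have "omega_AMSE k \<gamma> \<rho> lam b c = (\<chi> j. (1 + e - p * B $ j) / (v $ j * ((1 + e) * a - p\<^sup>2)))"
    unfolding omega_AMSE_def arg_min min by simp
  then show "AMSE k \<gamma> \<rho> lam b c (omega_AMSE k \<gamma> \<rho> lam b c)
      = (1 / real k) * ((1 + e) / ((1 + e) * a - p\<^sup>2))"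
    unfolding AMSE f_def by (simp only: min(2))
qed

section \<open>Signs of the two brackets\<close>

text \<open>Jensen's inequality by hand: the tangent bound at the mean 1 is summed with weights
  \<open>1 / c $ j\<close>, and its linear part sums to zero.\<close>

lemma Ssum_ge_Ssum_0:
  fixes b c :: "real ^ 'm"
  assumes b: "\<And>j. b $ j > 0" and c: "\<And>j. c $ j > 0" and "\<rho> \<le> 0"
  shows "Ssum b c 0 \<le> Ssum b c \<rho>"
proof -
  note d = dvec_pos[of b c, OF b c]
  note S0 = Ssum_0[of b c, OF b c]
  have b_sum: "(\<Sum>j\<in>UNIV. 1 / b $ j) > 0" using b by (intro sum_pos) auto
  \<comment> \<open>The factor \<open>c $ j\<close> cancels, and the normalization in
    \<open>dvec\<close> makes the weighted mean equal to 1.\<close>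
  have "(\<Sum>j\<in>UNIV. dvec b c $ j / c $ j)
      = (\<Sum>j\<in>UNIV. (1 / b $ j) * ((\<Sum>i\<in>UNIV. 1 / c $ i) / (\<Sum>i\<in>UNIV. 1 / b $ i)))"
    using less_imp_neq[OF c, symmetric] by (intro sum.cong) (auto simp: dvec_def)
  also have "\<dots> = (\<Sum>j\<in>UNIV. 1 / c $ j)"
    unfolding sum_distrib_right[symmetric] using b_sum by simp
  finally have mean: "(\<Sum>j\<in>UNIV. dvec b c $ j / c $ j) = (\<Sum>j\<in>UNIV. 1 / c $ j)" .
  have "Ssum b c 0 = (\<Sum>j\<in>UNIV. 1 / c $ j + \<rho> * (dvec b c $ j / c $ j - 1 / c $ j))"
    unfolding S0 by (simp add: sum.distrib sum_subtractf mean flip: sum_distrib_left)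
  also have "\<dots> = (\<Sum>j\<in>UNIV. (1 + \<rho> * (dvec b c $ j - 1)) / c $ j)"
    by (simp add: add_divide_distrib diff_divide_distrib right_diff_distrib)
  also have "\<dots> \<le> Ssum b c \<rho>"
    unfolding Ssum_def using powr_ge_tangent[OF d \<open>\<rho> \<le> 0\<close>] c
    by (intro sum_mono divide_right_mono) (auto simp: less_imp_le)
  finally show ?thesis .
qed

lemma Ssum_Cauchy_Schwarz:
  fixes b c :: "real ^ 'm"
  assumes b: "\<And>j. b $ j > 0" and c: "\<And>j. c $ j > 0"
  shows "(Ssum b c \<rho>)\<^sup>2 \<le> Ssum b c 0 * Ssum b c (2 * \<rho>)"
  using Cauchy_Schwarz_weighted_sum[of UNIV "\<lambda>j. 1 / c $ j" "\<lambda>j. dvec b c $ j powr \<rho>"] less_imp_le[OF c]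
  by (simp add: Ssum_0[of b c, OF b c] Ssum_def[of b c \<rho>] Ssum_def[of b c "2 * \<rho>"] dvec_powr_double)

section \<open>From the comparison of minima to the threshold\<close>

text \<open>Here \<open>s\<close>, \<open>r\<close>, \<open>t\<close> stand for \<open>S 0\<close>,
  \<open>S \<rho>\<close>, \<open>S (2 * \<rho>)\<close>. The common factor
  \<open>\<mu>\<^sup>2\<close> is kept so that the equivalence also covers \<open>\<mu> = 0\<close>,
  where both sides hold with equality.\<close>

lemma minimum_ge_iff:
  fixes \<gamma> \<mu> s r t :: real
  assumes "\<gamma> > 0" "s > 0"
  defines "p \<equiv> \<mu> * r / (\<gamma>\<^sup>2 * s)" and "e \<equiv> \<mu>\<^sup>2 * t / (\<gamma>\<^sup>2 * s)"
  assumes N: "(1 + e) * (1 / \<gamma>\<^sup>2) - p\<^sup>2 > 0"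
  shows "\<mu>\<^sup>2 + \<gamma>\<^sup>2 \<le> (1 + e) / ((1 + e) * (1 / \<gamma>\<^sup>2) - p\<^sup>2)
    \<longleftrightarrow> \<mu>\<^sup>2 * (\<mu>\<^sup>2 * (s * t - r\<^sup>2)) \<le> \<mu>\<^sup>2 * (\<gamma>\<^sup>2 * (r\<^sup>2 - s\<^sup>2))"
proof -
  have "\<mu>\<^sup>2 + \<gamma>\<^sup>2 \<le> (1 + e) / ((1 + e) * (1 / \<gamma>\<^sup>2) - p\<^sup>2)
      \<longleftrightarrow> (\<mu>\<^sup>2 + \<gamma>\<^sup>2) * ((1 + e) * (1 / \<gamma>\<^sup>2) - p\<^sup>2) - (1 + e) \<le> 0"
    using N by (simp add: pos_le_divide_eq)
  \<comment> \<open>The product \<open>\<gamma>\<^sup>2 * ((1 + e) * (1 / \<gamma>\<^sup>2))\<close>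
    cancels \<open>1 + e\<close>; every remaining term contains
    \<open>\<mu>\<^sup>2\<close>.\<close>
  also have "(\<mu>\<^sup>2 + \<gamma>\<^sup>2) * ((1 + e) * (1 / \<gamma>\<^sup>2) - p\<^sup>2) - (1 + e)
      = (\<mu>\<^sup>2 * (\<mu>\<^sup>2 * (s * t - r\<^sup>2)) - \<mu>\<^sup>2 * (\<gamma>\<^sup>2 * (r\<^sup>2 - s\<^sup>2))) / (\<gamma> ^ 4 * s\<^sup>2)"
    using assms(1,2) unfolding p_def e_def by (simp add: field_simps) algebra
  also have "\<dots> \<le> 0 \<longleftrightarrow> \<mu>\<^sup>2 * (\<mu>\<^sup>2 * (s * t - r\<^sup>2)) \<le> \<mu>\<^sup>2 * (\<gamma>\<^sup>2 * (r\<^sup>2 - s\<^sup>2))"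
  proof -
    have "\<gamma> ^ 4 * s\<^sup>2 > 0" using assms(1,2) by simp
    then show ?thesis by (simp only: divide_le_0_iff) linarith
  qed
  finally show ?thesis .
qed

lemma abs_le_lambda0_iff:
  fixes b c :: "real ^ 'm" and \<gamma> \<rho> lam :: real
  assumes b: "\<And>j. b $ j > 0" and c: "\<And>j. c $ j > 0" and "\<gamma> > 0" "\<rho> \<le> 0"
  defines "S \<equiv> Ssum b c" and "\<mu> \<equiv> lam / (1 - \<rho>)"
  shows "ereal \<bar>lam\<bar> \<le> lambda0 \<gamma> \<rho> b c
    \<longleftrightarrow> \<mu>\<^sup>2 * (S 0 * S (2 * \<rho>) - (S \<rho>)\<^sup>2) \<le> \<gamma>\<^sup>2 * ((S \<rho>)\<^sup>2 - (S 0)\<^sup>2)"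
proof -
  define D R where "D = S 0 * S (2 * \<rho>) - (S \<rho>)\<^sup>2" and "R = (S \<rho>)\<^sup>2 - (S 0)\<^sup>2"
  have "D \<ge> 0" unfolding D_def S_def using Ssum_Cauchy_Schwarz[OF b c] by simp
  have "R \<ge> 0"
    using Ssum_ge_Ssum_0[OF b c \<open>\<rho> \<le> 0\<close>] Ssum_0_pos[OF b c]
    by (simp add: R_def S_def power_mono)
  have "ereal \<bar>lam\<bar> \<le> lambda0 \<gamma> \<rho> b c \<longleftrightarrow> \<mu>\<^sup>2 * D \<le> \<gamma>\<^sup>2 * R"
  proof (cases "D = 0")
    \<comment> \<open>The threshold is infinite, and the right-hand condition reads
      \<open>0 \<le> \<gamma>\<^sup>2 * R\<close>.\<close>
    case True
    then show ?thesis
      using \<open>R \<ge> 0\<close> by (simp add: lambda0_def Let_def D_def S_def)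
  next
    case False
    have "ereal \<bar>lam\<bar> \<le> lambda0 \<gamma> \<rho> b c \<longleftrightarrow> \<bar>lam\<bar> \<le> \<gamma> * (1 - \<rho>) * sqrt (R / D)"
      using False by (simp add: lambda0_def Let_def D_def R_def S_def)
    also have "\<dots> \<longleftrightarrow> \<bar>\<mu>\<bar> \<le> \<gamma> * sqrt (R / D)"
      using \<open>\<rho> \<le> 0\<close> by (simp add: \<mu>_def abs_divide pos_divide_le_eq mult_ac)
    \<comment> \<open>Squaring is an equivalence because \<open>R / D \<ge> 0\<close> makes the
      bound nonnegative.\<close>
    also have "\<dots> \<longleftrightarrow> \<mu>\<^sup>2 \<le> (\<gamma> * sqrt (R / D))\<^sup>2"
      using \<open>\<gamma> > 0\<close> \<open>R \<ge> 0\<close> \<open>D \<ge> 0\<close> by (simp flip: abs_le_square_iff)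
    also have "\<dots> \<longleftrightarrow> \<mu>\<^sup>2 * D \<le> \<gamma>\<^sup>2 * R"
      using False \<open>R \<ge> 0\<close> \<open>D \<ge> 0\<close> by (simp add: power_mult_distrib pos_le_divide_eq)
    finally show ?thesis .
  qed
  then show ?thesis by (simp add: D_def R_def)
qed

theorem theorem4:
  fixes M :: "'w measure"
    and X :: "nat \<Rightarrow> 'm::finite \<Rightarrow> 'w \<Rightarrow> real"
    and F A :: "real \<Rightarrow> real"
    and \<gamma> \<rho> lam :: real
    and n\<^sub>s k\<^sub>s :: "'m \<Rightarrow> nat \<Rightarrow> nat"
    and k :: "nat \<Rightarrow> nat"
    and j\<^sub>1 :: 'm
    and b c :: "real ^ 'm"
    and n :: nat
  assumes "prob_space M"
    and "continuous_on UNIV F"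
    and "\<And>n. prob_space.indep_vars M (\<lambda>_. borel) (\<lambda>(i, j). X i j)
               {(i, j). 1 \<le> i \<and> i \<le> n\<^sub>s j n}"
    and "\<And>n i j. 1 \<le> i \<Longrightarrow> i \<le> n\<^sub>s j n \<Longrightarrow> cdf (distr M borel (X i j)) = F"
    and "second_order_C2 F \<gamma> \<rho> A"
    and "\<And>n. (\<Sum>j\<in>UNIV. n\<^sub>s j n) = n"
    and "\<And>j n. k\<^sub>s j n \<ge> 1"
    and "\<And>j. (\<lambda>n. real (n\<^sub>s j\<^sub>1 n) / real (n\<^sub>s j n)) \<longlonglongrightarrow> b $ j"
    and "\<And>j. b $ j > 0"
    and "\<And>j. (\<lambda>n. real (k\<^sub>s j\<^sub>1 n) / real (k\<^sub>s j n)) \<longlonglongrightarrow> c $ j"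
    and "\<And>j. c $ j > 0"
    and "\<And>n. k n = (\<Sum>j\<in>UNIV. k\<^sub>s j n)"
    and "filterlim k at_top sequentially"
    and "(\<lambda>n. real (k n) / real n) \<longlonglongrightarrow> 0"
    and "(\<lambda>n. sqrt (real (k n)) * A (real n / real (k n))) \<longlonglongrightarrow> lam"
    and "\<not> (\<forall>j. b $ j / c $ j = 1)"
  shows "(\<exists>!\<omega>. is_AMSE_minimizer (k n) \<gamma> \<rho> lam b c \<omega>) \<and>
         (AMSE (k n) \<gamma> \<rho> lam b c (omega_AMSE (k n) \<gamma> \<rho> lam b c) \<ge> AMSE_Hill (k n) \<gamma> \<rho> lam \<longleftrightarrow>
          ereal \<bar>lam\<bar> \<le> lambda0 \<gamma> \<rho> b c)"
proof -
  define S \<mu> where "S = Ssum b c" and "\<mu> = lam / (1 - \<rho>)"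
  note b = assms(9) and c = assms(11)
  have \<gamma>: "\<gamma> > 0" and \<rho>: "\<rho> \<le> 0" using assms(5) by (auto simp: second_order_C2_def)
  \<comment> \<open>One subsample already gives \<open>k n > 0\<close>, so
    \<open>1 / real (k n)\<close> is a positive factor that can be cancelled at this
    \<open>n\<close>.\<close>
  have "0 < k\<^sub>s j\<^sub>1 n" using assms(7)[where j = j\<^sub>1 and n = n] by simp
  also have "\<dots> \<le> k n" unfolding assms(12) by (intro member_le_sum) auto
  finally have k: "k n > 0" .
  note min = AMSE_minimum[where lam = lam and \<rho> = \<rho>, OF k \<gamma> b c, folded S_def \<mu>_def]
  have S0: "S 0 > 0" unfolding S_def by (rule Ssum_0_pos[OF b c])
  have "AMSE_Hill (k n) \<gamma> \<rho> lam = (1 / real (k n)) * (\<mu>\<^sup>2 + \<gamma>\<^sup>2)"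
    by (simp add: AMSE_Hill_def \<mu>_def power_divide)
  then have "AMSE (k n) \<gamma> \<rho> lam b c (omega_AMSE (k n) \<gamma> \<rho> lam b c) \<ge> AMSE_Hill (k n) \<gamma> \<rho> lam
      \<longleftrightarrow> \<mu>\<^sup>2 * (\<mu>\<^sup>2 * (S 0 * S (2 * \<rho>) - (S \<rho>)\<^sup>2)) \<le> \<mu>\<^sup>2 * (\<gamma>\<^sup>2 * ((S \<rho>)\<^sup>2 - (S 0)\<^sup>2))"
    using minimum_ge_iff[OF \<gamma> S0 min(2)]
      mult_le_cancel_left_pos[of "1 / real (k n)", unfolded zero_less_divide_1_iff of_nat_0_less_iff, OF k]
    unfolding min(3) by (simp only:)
  also have "\<dots> \<longleftrightarrow> \<mu>\<^sup>2 * (S 0 * S (2 * \<rho>) - (S \<rho>)\<^sup>2) \<le> \<gamma>\<^sup>2 * ((S \<rho>)\<^sup>2 - (S 0)\<^sup>2)"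
  proof (cases "\<mu> = 0")
    \<comment> \<open>The left side is \<open>0 \<le> 0\<close>, and the right side reduces to
      \<open>S 0 \<le> S \<rho>\<close> between positive numbers.\<close>
    case True
    then show ?thesis
      using Ssum_ge_Ssum_0[OF b c \<rho>] S0 by (simp add: S_def power_mono)
  next
    case False
    then have "\<mu>\<^sup>2 > 0" by simp
    then show ?thesis by (simp only: mult_le_cancel_left_pos)
  qed
  also have "\<dots> \<longleftrightarrow> ereal \<bar>lam\<bar> \<le> lambda0 \<gamma> \<rho> b c"
    unfolding S_def \<mu>_def by (rule abs_le_lambda0_iff[OF b c \<gamma> \<rho>, symmetric])
  finally show ?thesis using min(1) by blast
qed

end
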